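(* Let $q$ be a prime power. If there exists a $2$-$(7,3,1)_q$ subspace design, then there exists a $2$-$(7,3,q^4)_q$ subspace design.
   Context: For a prime power $q$ and an $\mathbb{F}_q$-vector space $V$ of dimension $v$, a $t$-$(v,k,\lambda)_q$ subspace design is a set $D$ of $k$-dimensional subspaces (blocks) of $V$ such that each $t$-dimensional subspace of $V$ is contained in exactly $\lambda$ blocks of $D$ (in particular, blocks are not repeated). *)

theory Defs
  imports Complex_Main "HOL-Library.Cardinality" "HOL-Number_Theory.Prime_Powers"
begin

text \<open>
  The ambient space \<open>V\<close> is the whole type \<open>'b\<close>, with scalar multiplication \<open>scale\<close> by elements of
  the finite field \<open>'a\<close> of order \<open>q\<close>.  The dimension of \<open>V\<close> is stated through a finite basis, since
  \<open>dim UNIV = 0\<close> also holds for infinite-dimensional spaces.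
\<close>

definition subspace_design ::
  "nat \<Rightarrow> ('a::{field,finite} \<Rightarrow> 'b::ab_group_add \<Rightarrow> 'b) \<Rightarrow>
   nat \<Rightarrow> nat \<Rightarrow> nat \<Rightarrow> nat \<Rightarrow> 'b set set \<Rightarrow> bool"
  where
  "subspace_design q scale t v k l D \<longleftrightarrow>
     CARD('a) = q \<and>
     (\<exists>B. finite_dimensional_vector_space scale B \<and> card B = v) \<and>
     (\<forall>U\<in>D. module.subspace scale U \<and> vector_space.dim scale U = k) \<and>
     (\<forall>T. module.subspace scale T \<and> vector_space.dim scale T = t \<longrightarrow>
        card {U\<in>D. T \<subseteq> U} = l)"

end

theory Submission
  imports Defs
begin

text \<open>
  Let \<open>D\<close> be a \<open>2-(7,3,1)\<^sub>q\<close> design. Counting vectors and ordered independent pairs shows that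
  every 5-dimensional subspace contains exactly \<open>q\<^sup>2 + 1\<close> blocks of \<open>D\<close>, while a 4-dimensional
  subspace contains at most one block, because two of its 3-dimensional subspaces share a line.
  Each block lies in \<open>q + 1\<close> hyperplanes of a 5-dimensional space, so of the
  \<open>q\<^sup>4 + q\<^sup>3 + q\<^sup>2 + q + 1\<close> hyperplanes exactly \<open>q\<^sup>4\<close> contain no block. Passing to
  orthogonal complements, the duals of the 4-dimensional subspaces without blocks form the
  required design.
\<close>

subsection \<open>Orthogonal complements\<close>

context finite_dimensional_vector_space
begin

text \<open>The standard dot product in \<open>Basis\<close> coordinates. Over a finite field it can
  have isotropic vectors, so \<open>perp A\<close> need not be a direct complement of
  \<open>span A\<close>; only the dimension formula and the reversal of inclusions are used.\<close>

definition coord_form :: "'b \<Rightarrow> 'b \<Rightarrow> 'a" where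
  "coord_form x y = (\<Sum>b\<in>Basis. representation Basis x b * representation Basis y b)"

definition perp :: "'b set \<Rightarrow> 'b set" where
  "perp A = {y. \<forall>x\<in>A. coord_form x y = 0}"

lemma coord_form_commute: "coord_form x y = coord_form y x"
  by (simp add: coord_form_def mult.commute)

lemma coord_form_add_right: "coord_form x (y + z) = coord_form x y + coord_form x z"
  by (simp add: coord_form_def representation_add independent_Basis span_Basis
      distrib_left sum.distrib)

lemma coord_form_scale_right: "coord_form x (scale c y) = c * coord_form x y"
  by (simp add: coord_form_def representation_scale independent_Basis span_Basis
      sum_distrib_left mult.left_commute)

lemma coord_form_zero_right: "coord_form x 0 = 0"
  using coord_form_scale_right[of x 0 0] by simp

lemma coord_form_diff_right: "coord_form x (y - z) = coord_form x y - coord_form x z"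
  using coord_form_add_right[of x "y - z" z] by simp

lemma subspace_perp: "subspace (perp A)"
  by (auto simp: subspace_def perp_def coord_form_zero_right coord_form_add_right
      coord_form_scale_right)

text \<open>Symmetry of the form makes \<open>perp\<close> a Galois connection with itself. This is
  the duality that later turns "a block inside \<open>perp K\<close>" into "\<open>K\<close> inside
  the \<open>perp\<close> of a block".\<close>

lemma subset_perp_iff: "A \<subseteq> perp B \<longleftrightarrow> B \<subseteq> perp A"
  unfolding perp_def using coord_form_commute by fastforce

lemma perp_span: "perp (span A) = perp A"
  by (meson antisym order_refl span_minimal span_superset subset_perp_iff subset_trans subspace_perp)

lemma perp_insert: "perp (insert a A) = perp A \<inter> {y. coord_form a y = 0}"
  by (auto simp: perp_def)

lemma perp_empty: "perp {} = UNIV"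
  by (simp add: perp_def)

text \<open>Nondegeneracy: pairing with a basis vector reads off the corresponding
  coordinate.\<close>

lemma perp_UNIV: "perp UNIV = {0}"
proof -
  have "y = 0" if y: "y \<in> perp UNIV" for y
  proof -
    have "representation Basis y b = 0" if b: "b \<in> Basis" for b
    proof -
      have "coord_form b y = (\<Sum>c\<in>Basis. (if c = b then 1 else 0) * representation Basis y c)"
        unfolding coord_form_def using b independent_Basis by (simp add: representation_basis)
      also have "\<dots> = (\<Sum>c\<in>Basis. if c = b then representation Basis y c else 0)"
        by (intro sum.cong) auto
      also have "\<dots> = representation Basis y b"
        using b finite_Basis by simp
      finally show ?thesis
        using y by (simp add: perp_def)
    qed
    then have "(\<Sum>b\<in>Basis. scale (representation Basis y b) b) = 0"
      by simp
    then show ?thesis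
      using sum_representation_eq[OF independent_Basis, of y Basis] span_Basis finite_Basis by simp
  qed
  then show ?thesis
    using subspace_0[OF subspace_perp] by blast
qed

text \<open>If the functional is nonzero at some \<open>w\<close> in \<open>W\<close>, subtracting a
  multiple of \<open>w\<close> moves any vector of \<open>W\<close> into the kernel, so the kernel
  part and \<open>w\<close> together span \<open>W\<close>.\<close>

lemma dim_le_dim_Int_kernel:
  assumes "subspace W"
  shows "dim W \<le> dim (W \<inter> {y. coord_form a y = 0}) + 1"
proof (cases "W \<subseteq> {y. coord_form a y = 0}")
  case True
  then show ?thesis by (simp add: Int_absorb2)
next
  case False
  then obtain w where w: "w \<in> W" "coord_form a w \<noteq> 0" by auto
  let ?K = "W \<inter> {y. coord_form a y = 0}"
  have "W \<subseteq> span (insert w ?K)"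
  proof
    fix y assume y: "y \<in> W"
    let ?c = "coord_form a y / coord_form a w"
    have "y - scale ?c w \<in> ?K"
      using assms w y by (simp add: subspace_diff subspace_scale coord_form_diff_right
          coord_form_scale_right)
    then have "y - scale ?c w \<in> span ?K" by (rule span_base)
    then show "y \<in> span (insert w ?K)"
      unfolding span_breakdown_eq by (rule exI)
  qed
  then have "dim W \<le> dim (insert w ?K)" by (rule dim_mono)
  also have "\<dots> \<le> dim ?K + 1" by (simp add: dim_insert)
  finally show ?thesis .
qed

lemma dim_perp_le:
  assumes "finite C"
  shows "dim (perp A) \<le> dim (perp (C \<union> A)) + card C"
  using assms
proof induction
  case (insert c C)
  then show ?case
    using dim_le_dim_Int_kernel[OF subspace_perp, of "C \<union> A" c]
    by (simp add: perp_insert)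
qed simp

text \<open>Each vector imposes one linear condition and lowers the dimension by at most 1. A basis
  \<open>C\<close> of \<open>A\<close> cuts the whole space down to \<open>perp A\<close>, which
  bounds its dimension from below. Extending \<open>C\<close> to a basis \<open>E\<close> of the
  space cuts \<open>perp A\<close> down to \<open>{0}\<close> with \<open>card (E - C)\<close>
  further conditions, which bounds it from above.\<close>

lemma dim_perp: "dim (perp A) + dim A = card Basis"
proof -
  obtain C where C: "C \<subseteq> A" "independent C" "A \<subseteq> span C" "card C = dim A"
    by (rule basis_exists)
  have pC: "perp C = perp A"
    using perp_span[of A] perp_span[of C] C(1,3) span_mono[of C A] span_minimal[of A "span C"]
    by force
  obtain E where E: "C \<subseteq> E" "independent E" "span E = UNIV"
    using maximal_independent_subset_extend[of C UNIV] C(2) by (metis subset_UNIV top.extremum_unique)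
  have fin: "finite E" "finite C"
    using E C finiteI_independent by auto
  have cE: "card E = card Basis"
    using dim_eq_card[of E UNIV] E by auto
  have "perp ((E - C) \<union> C) = {0}"
    using E perp_span[of E] perp_UNIV by (simp add: Un_absorb2)
  then have "dim (perp A) \<le> card (E - C)"
    using dim_perp_le[of "E - C" C] fin pC by simp
  moreover have "card (E - C) = card E - card C" "card C \<le> card E"
    using E fin by (auto simp: card_Diff_subset card_mono)
  moreover have "card Basis \<le> dim (perp A) + card C"
    using dim_perp_le[of C "{}"] fin pC by (simp add: perp_empty)
  ultimately show ?thesis using C cE by simp
qed

end

subsection \<open>Counting in vector spaces over finite fields\<close>

locale finite_field_vector_space = finite_dimensional_vector_space scale Basis
  for scale :: "'a::{field,finite} \<Rightarrow> 'b::ab_group_add \<Rightarrow> 'b" (infixr \<open>*s\<close> 75) and Basis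
begin

text \<open>Adjoining an independent vector \<open>c\<close> multiplies the size by
  \<open>CARD('a)\<close>, as every vector of the new span is \<open>k *s c + x\<close> for a unique
  pair \<open>(k, x)\<close>.\<close>

lemma card_span_independent:
  assumes "finite C" "independent C"
  shows "finite (span C) \<and> card (span C) = CARD('a) ^ card C"
  using assms
proof induction
  case (insert c C)
  then have ind: "independent C" and c: "c \<notin> span C"
    by (simp_all add: independent_insert)
  have eq: "span (insert c C) = (\<lambda>(k, x). k *s c + x) ` (UNIV \<times> span C)"
  proof (intro equalityI subsetI)
    fix y assume "y \<in> span (insert c C)"
    then obtain k where "y - k *s c \<in> span C" unfolding span_breakdown_eq by blast
    then show "y \<in> (\<lambda>(k, x). k *s c + x) ` (UNIV \<times> span C)"
      by (intro image_eqI[of _ _ "(k, y - k *s c)"]) auto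
  next
    fix y assume "y \<in> (\<lambda>(k, x). k *s c + x) ` (UNIV \<times> span C)"
    then obtain k x where "x \<in> span C" "y = k *s c + x" by auto
    then show "y \<in> span (insert c C)"
      unfolding span_breakdown_eq by (intro exI[of _ k]) simp
  qed
  have inj: "inj_on (\<lambda>(k, x). k *s c + x) (UNIV \<times> span C)"
  proof (rule inj_onI, clarify)
    fix k x l y
    assume x: "x \<in> span C" and y: "y \<in> span C" and e: "k *s c + x = l *s c + y"
    have "(k - l) *s c = y - x"
      using e by (simp add: scale_left_diff_distrib algebra_simps)
    then have "(k - l) *s c \<in> span C" using x y by (simp add: span_diff)
    then have "inverse (k - l) *s ((k - l) *s c) \<in> span C" by (rule span_scale)
    then have "k = l" using c by (cases "k = l") auto
    then show "k = l \<and> x = y" using e by simp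
  qed
  show ?case
    using insert ind by (simp add: eq card_image[OF inj] card_cartesian_product)
qed simp

lemma finite_universe: "finite (UNIV :: 'b set)"
  using card_span_independent[OF finite_Basis independent_Basis] span_Basis by simp

lemma finite_any: "finite (A :: 'b set)"
  by (rule finite_subset[OF subset_UNIV finite_universe])

lemma finite_any_family: "finite (F :: 'b set set)"
  by (metis Pow_UNIV finite_Pow_iff finite_subset finite_universe subset_UNIV)

lemma card_subspace:
  assumes "subspace W"
  shows "card W = CARD('a) ^ dim W"
proof -
  obtain C where "finite C" "independent C" "span C = W" "card C = dim W"
    using basis_subspace_exists[OF assms] by metis
  then show ?thesis using card_span_independent[of C] by simp
qed

text \<open>Double counting of pairs \<open>(x, K)\<close> with \<open>x\<close> in \<open>K\<close>
  and in \<open>X - W\<close>: each \<open>x\<close> lies in the single subspace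
  \<open>span (insert x W)\<close>, and each \<open>K\<close> contains \<open>q^(w+1) - q^w\<close>
  such vectors, where \<open>w = dim W\<close>. The factor \<open>CARD('a) - 1\<close> stays on the
  left to avoid division.\<close>

lemma card_subspaces_between:
  assumes W: "subspace W" and X: "subspace X" and "W \<subseteq> X"
  shows "card {K. subspace K \<and> W \<subseteq> K \<and> K \<subseteq> X \<and> dim K = dim W + 1} * (CARD('a) - 1)
    = CARD('a) ^ (dim X - dim W) - 1"
proof -
  let ?q = "CARD('a)" and ?w = "dim W"
  let ?S = "{K. subspace K \<and> W \<subseteq> K \<and> K \<subseteq> X \<and> dim K = ?w + 1}"
  have one: "card {K\<in>?S. x \<in> K} = 1" if x: "x \<in> X - W" for x
  proof -
    have sW: "span W = W" using W by (simp add: span_eq_iff)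
    have d: "dim (span (insert x W)) = ?w + 1" using x by (simp add: dim_insert sW)
    have "{K\<in>?S. x \<in> K} = {span (insert x W)}"
    proof (intro equalityI subsetI)
      fix K assume "K \<in> {K\<in>?S. x \<in> K}"
      then have K: "subspace K" "W \<subseteq> K" "x \<in> K" "dim K = ?w + 1" by auto
      then have "span (insert x W) \<subseteq> K" by (simp add: span_minimal)
      then have "span (insert x W) = K"
        using K d by (intro subspace_dim_equal) auto
      then show "K \<in> {span (insert x W)}" by simp
    next
      fix K assume "K \<in> {span (insert x W)}"
      moreover have "span (insert x W) \<subseteq> X"
        using x X \<open>W \<subseteq> X\<close> by (intro span_minimal) auto
      moreover have "insert x W \<subseteq> span (insert x W)" by (rule span_superset)
      ultimately show "K \<in> {K\<in>?S. x \<in> K}" using d by auto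
    qed
    then show ?thesis by simp
  qed
  have "(\<Sum>K\<in>?S. card {x\<in>X - W. x \<in> K}) = 1 * card (X - W)"
    using one by (intro sum_multicount finite_any finite_any_family) blast
  moreover have "card {x\<in>X - W. x \<in> K} = ?q ^ ?w * (?q - 1)" if "K \<in> ?S" for K
  proof -
    have "{x\<in>X - W. x \<in> K} = K - W" using that by auto
    then show ?thesis
      using that W by (simp add: card_Diff_subset finite_any card_subspace algebra_simps)
  qed
  moreover have "card (X - W) = ?q ^ ?w * (?q ^ (dim X - ?w) - 1)"
    using assms dim_subset[OF \<open>W \<subseteq> X\<close>]
    by (simp add: card_Diff_subset finite_any card_subspace right_diff_distrib' flip: power_add)
  ultimately have "?q ^ ?w * (card ?S * (?q - 1)) = ?q ^ ?w * (?q ^ (dim X - ?w) - 1)"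
    by (simp add: ac_simps)
  then show ?thesis
    by (subst (asm) mult_cancel1) simp
qed

lemma CARD_field_ge_2: "2 \<le> CARD('a)"
proof -
  have "card {0, 1 :: 'a} \<le> CARD('a)" by (intro card_mono) auto
  then show ?thesis by simp
qed

lemma card_subspaces_between_codim_2:
  assumes "subspace W" "subspace X" "W \<subseteq> X" "dim X = dim W + 2"
  shows "card {K. subspace K \<and> W \<subseteq> K \<and> K \<subseteq> X \<and> dim K = dim W + 1} = CARD('a) + 1"
proof -
  let ?q = "CARD('a)"
  have "card {K. subspace K \<and> W \<subseteq> K \<and> K \<subseteq> X \<and> dim K = dim W + 1} * (?q - 1) = ?q ^ 2 - 1"
    using card_subspaces_between[OF assms(1-3)] assms(4) by simp
  also have "\<dots> = (?q + 1) * (?q - 1)"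
    by (simp add: algebra_simps power2_eq_square)
  finally show ?thesis
    by (subst (asm) mult_cancel2) (use CARD_field_ge_2 in simp)
qed

text \<open>Ordered bases of the 2-dimensional subspaces of \<open>W\<close>. Counting these instead
  of the subspaces themselves avoids Gaussian binomials and division.\<close>

definition indep_pairs :: "'b set \<Rightarrow> ('b \<times> 'b) set" where
  "indep_pairs W = Sigma (W - {0}) (\<lambda>x. W - span {x})"

lemma card_Diff_span_singleton:
  assumes "subspace W" "x \<in> W" "x \<noteq> 0"
  shows "card (W - span {x}) = CARD('a) ^ dim W - CARD('a)"
proof -
  have "span {x} \<subseteq> W" using assms by (simp add: span_minimal)
  moreover have "card (span {x}) = CARD('a)"
    using assms card_subspace[OF subspace_span, of "{x}"] by simp
  ultimately show ?thesis
    using assms by (simp add: card_Diff_subset finite_any card_subspace)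
qed

lemma card_nonzero:
  assumes "subspace W"
  shows "card (W - {0}) = CARD('a) ^ dim W - 1"
  using assms by (simp add: card_Diff_subset finite_any card_subspace subspace_0)

lemma card_indep_pairs:
  assumes "subspace W"
  shows "card (indep_pairs W) = (CARD('a) ^ dim W - 1) * (CARD('a) ^ dim W - CARD('a))"
proof -
  have "card (indep_pairs W) = (\<Sum>x\<in>W - {0}. card (W - span {x}))"
    unfolding indep_pairs_def by (rule card_SigmaI) (auto simp: finite_any)
  also have "\<dots> = (\<Sum>x\<in>W - {0}. CARD('a) ^ dim W - CARD('a))"
    using assms by (intro sum.cong) (auto simp: card_Diff_span_singleton)
  finally show ?thesis using card_nonzero[OF assms] by simp
qed

lemma finite_indep_pairs: "finite (indep_pairs W)"
  by (simp add: indep_pairs_def finite_any)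

lemma indep_pairs_nonempty:
  assumes "subspace W" "2 \<le> dim W"
  obtains x y where "(x, y) \<in> indep_pairs W"
proof -
  have "\<not> W \<subseteq> {0}" using assms dim_eq_0[of W] by linarith
  then obtain x where x: "x \<in> W" "x \<noteq> 0" by auto
  have "\<not> W \<subseteq> span {x}"
    using dim_mono[of W "{x}"] x assms by auto
  then show ?thesis using x that by (auto simp: indep_pairs_def)
qed

text \<open>The sum of \<open>S\<close> and \<open>T\<close> stays inside \<open>X\<close>, so the
  dimension formula for sums applies.\<close>

lemma dim_Int_ge:
  assumes "subspace S" "subspace T" "subspace X" "S \<subseteq> X" "T \<subseteq> X"
  shows "dim S + dim T \<le> dim X + dim (S \<inter> T)"
proof -
  have "{x + y |x y. x \<in> S \<and> y \<in> T} \<subseteq> X"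
    using assms by (auto intro: subspace_add)
  from dim_subset[OF this] show ?thesis
    using dim_sums_Int[OF assms(1,2)] by linarith
qed

end

subsection \<open>Designs with \<open>t = 2\<close> and \<open>\<lambda> = 1\<close>\<close>

locale subspace_steiner_system = finite_field_vector_space +
  fixes D :: "'b set set" and k :: nat
  assumes subspace_block: "U \<in> D \<Longrightarrow> subspace U"
    and dim_block: "U \<in> D \<Longrightarrow> dim U = k"
    and card_blocks_line: "\<lbrakk>subspace T; dim T = 2\<rbrakk> \<Longrightarrow> card {U\<in>D. T \<subseteq> U} = 1"
begin

lemma card_blocks_pair:
  assumes "(x, y) \<in> indep_pairs W"
  shows "card {U\<in>D. x \<in> U \<and> y \<in> U} = 1"
proof -
  have "dim (span {x, y}) = 2"
    using assms by (auto simp: indep_pairs_def dim_insert insert_commute[of x y])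
  then have "card {U\<in>D. span {x, y} \<subseteq> U} = 1"
    by (intro card_blocks_line) auto
  moreover have "{U\<in>D. span {x, y} \<subseteq> U} = {U\<in>D. x \<in> U \<and> y \<in> U}"
    using subspace_block span_minimal[of "{x, y}"] span_superset[of "{x, y}"] by auto
  ultimately show ?thesis by simp
qed

text \<open>An intersection of dimension at least 2 contains an independent pair, which lies in only
  one block.\<close>

lemma block_unique:
  assumes "U \<in> D" "U' \<in> D" "2 \<le> dim (U \<inter> U')"
  shows "U = U'"
proof -
  obtain x y where xy: "(x, y) \<in> indep_pairs (U \<inter> U')"
    using assms subspace_block by (metis indep_pairs_nonempty subspace_inter)
  then have mem: "x \<in> U" "y \<in> U" "x \<in> U'" "y \<in> U'" by (auto simp: indep_pairs_def)
  obtain Z where Z: "{U\<in>D. x \<in> U \<and> y \<in> U} = {Z}"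
    using card_blocks_pair[OF xy] card_1_singletonE by blast
  have "U \<in> {Z}" "U' \<in> {Z}"
    unfolding Z[symmetric] using mem assms by auto
  then show ?thesis by simp
qed

text \<open>Double counting: every independent pair of \<open>W\<close> lies in exactly one
  block.\<close>

lemma sum_indep_pairs_blocks:
  assumes "subspace W"
  shows "(\<Sum>U\<in>D. card (indep_pairs (U \<inter> W))) = card (indep_pairs W)"
proof -
  have "(\<Sum>U\<in>D. card {p\<in>indep_pairs W. fst p \<in> U \<and> snd p \<in> U}) = 1 * card (indep_pairs W)"
    using card_blocks_pair
    by (intro sum_multicount finite_any_family finite_indep_pairs) auto
  moreover have "{p\<in>indep_pairs W. fst p \<in> U \<and> snd p \<in> U} = indep_pairs (U \<inter> W)" for U
    by (auto simp: indep_pairs_def)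
  ultimately show ?thesis by simp
qed

text \<open>The blocks through \<open>x\<close> partition the vectors outside
  \<open>span {x}\<close>, because each such vector together with \<open>x\<close> determines one
  block.\<close>

lemma card_blocks_point:
  assumes "x \<noteq> 0"
  shows "card {U\<in>D. x \<in> U} * (CARD('a) ^ k - CARD('a)) = CARD('a) ^ card Basis - CARD('a)"
proof -
  let ?E = "{U\<in>D. x \<in> U}"
  have "card {U\<in>?E. y \<in> U} = 1" if "y \<in> UNIV - span {x}" for y
    using card_blocks_pair[of x y UNIV] that assms
    by (simp add: indep_pairs_def conj_assoc)
  then have "(\<Sum>U\<in>?E. card {y\<in>UNIV - span {x}. y \<in> U}) = 1 * card (UNIV - span {x})"
    by (intro sum_multicount finite_any_family finite_any) blast
  moreover have "card {y\<in>UNIV - span {x}. y \<in> U} = CARD('a) ^ k - CARD('a)" if "U \<in> ?E" for U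
  proof -
    have "{y\<in>UNIV - span {x}. y \<in> U} = U - span {x}" by auto
    then show ?thesis
      using that assms subspace_block dim_block by (simp add: card_Diff_span_singleton)
  qed
  ultimately show ?thesis
    using card_Diff_span_singleton[of UNIV x] assms by simp
qed

lemma sum_nonzero_blocks:
  assumes "subspace W" and "\<And>x. x \<noteq> 0 \<Longrightarrow> card {U\<in>D. x \<in> U} = r"
  shows "(\<Sum>U\<in>D. card (U \<inter> W - {0})) = r * card (W - {0})"
proof -
  have "(\<Sum>U\<in>D. card {x\<in>W - {0}. x \<in> U}) = r * card (W - {0})"
    using assms by (intro sum_multicount finite_any_family finite_any) auto
  moreover have "{x\<in>W - {0}. x \<in> U} = U \<inter> W - {0}" for U by auto
  ultimately show ?thesis by simp
qed

lemma card_blocks_times_pairs: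
  "card D * ((CARD('a) ^ k - 1) * (CARD('a) ^ k - CARD('a)))
    = (CARD('a) ^ card Basis - 1) * (CARD('a) ^ card Basis - CARD('a))"
  using sum_indep_pairs_blocks[OF subspace_UNIV]
  by (simp add: card_indep_pairs subspace_block dim_block)

end

subsection \<open>The \<open>q\<close>-analogue of the Fano plane\<close>

locale subspace_fano_plane = subspace_steiner_system scale Basis D 3
  for scale :: "'a::{field,finite} \<Rightarrow> 'b::ab_group_add \<Rightarrow> 'b" (infixr \<open>*s\<close> 75)
    and Basis and D +
  assumes card_Basis: "card Basis = 7"
begin

lemma card_blocks_point_fano:
  assumes "x \<noteq> 0"
  shows "card {U\<in>D. x \<in> U} = CARD('a) ^ 4 + CARD('a) ^ 2 + 1"
proof -
  let ?q = "CARD('a)"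
  have "?q ^ 1 < ?q ^ 3"
    using CARD_field_ge_2 by (intro power_strict_increasing) auto
  then have pos: "?q ^ 3 - ?q > 0" by simp
  have "card {U\<in>D. x \<in> U} * (?q ^ 3 - ?q) = ?q ^ 7 - ?q"
    using card_blocks_point[OF assms] card_Basis by simp
  \<comment> \<open>Padding both sides of the truncated subtraction makes each a multiple of
    \<open>q^4 + q^2 + 1\<close>: the first by \<open>q^3\<close>, the second by
    \<open>q\<close>.\<close>
  also have "\<dots> = (?q ^ 7 + (?q ^ 5 + ?q ^ 3)) - (?q + (?q ^ 5 + ?q ^ 3))"
    by (rule add_diff_cancel_right[symmetric])
  also have "\<dots> = (?q ^ 4 + ?q ^ 2 + 1) * (?q ^ 3 - ?q)"
    unfolding diff_mult_distrib2
    by (rule arg_cong2[of _ _ _ _ "(-)"]) (simp_all add: algebra_simps eval_nat_numeral)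
  finally show ?thesis
    by (subst (asm) mult_cancel2) (use pos in simp)
qed

text \<open>A block meets \<open>W\<close> in dimension 1, 2 or 3, as 3 + 5 - 7 = 1. The numbers of
  blocks of these three kinds satisfy three linear equations, from counting blocks, nonzero vectors
  and independent pairs; the proof eliminates the first two kinds.\<close>

lemma card_blocks_subset:
  assumes W: "subspace W" "dim W = 5"
  shows "card {U\<in>D. U \<subseteq> W} = CARD('a) ^ 2 + 1"
proof -
  define Q where "Q = int CARD('a)"
  have Q2: "2 \<le> Q" using CARD_field_ge_2 by (simp add: Q_def)
  have Qpow: "int (CARD('a) ^ i - 1) = Q ^ i - 1" for i
    by (simp add: Q_def of_nat_diff)
  \<comment> \<open>At \<open>i = 0\<close> the truncated difference is 0 while \<open>1 - Q\<close>
    is negative, so positivity of \<open>d U\<close> is needed below.\<close>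
  have Qpow': "int (CARD('a) ^ i - CARD('a)) = Q ^ i - Q" if "i > 0" for i
    using that by (simp add: Q_def of_nat_diff self_le_power)
  define b where "b = int (card D)"
  define a where "a = int (card {U\<in>D. U \<subseteq> W})"
  define d where "d U = dim (U \<inter> W)" for U
  have d: "d U > 0" "d U \<le> 3" "d U = 3 \<longleftrightarrow> U \<subseteq> W" if "U \<in> D" for U
  proof -
    have "3 + 5 \<le> 7 + d U"
      using dim_Int_ge[of U W UNIV] that subspace_block dim_block W card_Basis
      by (simp add: d_def)
    then show "d U > 0" by simp
    show "d U \<le> 3"
      using dim_subset[of "U \<inter> W" U] dim_block[OF that] by (simp add: d_def)
    show "d U = 3 \<longleftrightarrow> U \<subseteq> W"
      using subspace_dim_equal[of "U \<inter> W" U] that W subspace_block[OF that] dim_block[OF that]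
      by (auto simp: d_def subspace_inter Int_absorb2)
  qed
  have sub: "subspace (U \<inter> W)" if "U \<in> D" for U
    using that W subspace_block by (simp add: subspace_inter)
  have "int (\<Sum>U\<in>D. card (indep_pairs (U \<inter> W))) = (Q ^ 5 - 1) * (Q ^ 5 - Q)"
    unfolding sum_indep_pairs_blocks[OF W(1)] card_indep_pairs[OF W(1)] of_nat_mult Qpow W
    by (simp add: Qpow')
  moreover have "int (card (indep_pairs (U \<inter> W))) = (Q ^ d U - 1) * (Q ^ d U - Q)"
    if "U \<in> D" for U
    unfolding card_indep_pairs[OF sub[OF that]] of_nat_mult Qpow d_def[symmetric]
    using Qpow'[OF d(1)[OF that]] by simp
  ultimately have pairs: "(\<Sum>U\<in>D. (Q ^ d U - 1) * (Q ^ d U - Q)) = (Q ^ 5 - 1) * (Q ^ 5 - Q)"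
    by simp
  have "(\<Sum>U\<in>D. card (U \<inter> W - {0})) = (CARD('a) ^ 4 + CARD('a) ^ 2 + 1) * card (W - {0})"
    by (intro sum_nonzero_blocks W(1) card_blocks_point_fano)
  then have "int (\<Sum>U\<in>D. card (U \<inter> W - {0})) = (Q ^ 4 + Q ^ 2 + 1) * int (card (W - {0}))"
    by (simp only: Q_def of_nat_mult of_nat_add of_nat_power of_nat_1)
  also have "int (card (W - {0})) = Q ^ 5 - 1"
    unfolding card_nonzero[OF W(1)] Qpow W ..
  finally have "int (\<Sum>U\<in>D. card (U \<inter> W - {0})) = (Q ^ 4 + Q ^ 2 + 1) * (Q ^ 5 - 1)" .
  moreover have "int (card (U \<inter> W - {0})) = Q ^ d U - 1" if "U \<in> D" for U
    unfolding card_nonzero[OF sub[OF that]] Qpow d_def ..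
  ultimately have points: "(\<Sum>U\<in>D. Q ^ d U - 1) = (Q ^ 4 + Q ^ 2 + 1) * (Q ^ 5 - 1)"
    by simp
  have "b * ((Q ^ 3 - 1) * (Q ^ 3 - Q)) = (Q ^ 7 - 1) * (Q ^ 7 - Q)"
    using arg_cong[OF card_blocks_times_pairs, of int]
    unfolding of_nat_mult Qpow card_Basis b_def by (simp add: Qpow')
  also have "\<dots> = ((Q ^ 7 - 1) * (Q ^ 4 + Q ^ 2 + 1)) * (Q ^ 3 - Q)"
    by algebra
  finally have "b * (Q ^ 3 - 1) * (Q ^ 3 - Q) = ((Q ^ 7 - 1) * (Q ^ 4 + Q ^ 2 + 1)) * (Q ^ 3 - Q)"
    by (simp add: mult.assoc)
  moreover have "Q ^ 1 < Q ^ 3" "Q ^ 2 < Q ^ 3" "Q ^ 0 < Q ^ 3"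
    by (intro power_strict_increasing; use Q2 in simp)+
  then have pos: "Q ^ 3 - Q \<noteq> 0" "Q ^ 3 - Q ^ 2 \<noteq> 0" "Q ^ 3 - 1 \<noteq> 0" by auto
  ultimately have blocks: "b * (Q ^ 3 - 1) = (Q ^ 7 - 1) * (Q ^ 4 + Q ^ 2 + 1)"
    by simp
  \<comment> \<open>The polynomial \<open>(X - Q) (X - Q\<^sup>2)\<close> vanishes at \<open>X = Q ^ d U\<close> unless \<open>U \<subseteq> W\<close>.\<close>
  have "a * ((Q ^ 3 - Q) * (Q ^ 3 - Q ^ 2))
      = (\<Sum>U\<in>{U\<in>D. U \<subseteq> W}. (Q ^ d U - Q) * (Q ^ d U - Q ^ 2))"
  proof -
    have "d U = 3" if "U \<in> {U\<in>D. U \<subseteq> W}" for U using that d(3) by auto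
    then show ?thesis by (simp add: a_def)
  qed
  also have "\<dots> = (\<Sum>U\<in>D. (Q ^ d U - Q) * (Q ^ d U - Q ^ 2))"
  proof (intro sum.mono_neutral_left finite_any_family ballI)
    fix U assume U: "U \<in> D - {U\<in>D. U \<subseteq> W}"
    then have "d U = 1 \<or> d U = 2" using d[of U] by auto
    then show "(Q ^ d U - Q) * (Q ^ d U - Q ^ 2) = 0" by auto
  qed auto
  \<comment> \<open>The same polynomial in \<open>Q ^ d U\<close>, rewritten as a combination of the
    summands of \<open>pairs\<close>, those of \<open>points\<close>, and a constant.\<close>
  also have "\<dots> = (\<Sum>U\<in>D. (Q ^ d U - 1) * (Q ^ d U - Q)
      - (Q ^ 2 - 1) * (Q ^ d U - 1) + (Q ^ 2 - 1) * (Q - 1))"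
    by (intro sum.cong) (auto simp: algebra_simps power2_eq_square)
  also have "\<dots> = (\<Sum>U\<in>D. (Q ^ d U - 1) * (Q ^ d U - Q))
      - (Q ^ 2 - 1) * (\<Sum>U\<in>D. Q ^ d U - 1) + b * ((Q ^ 2 - 1) * (Q - 1))"
    by (subst sum.distrib, subst sum_subtractf) (simp only: sum_distrib_left sum_constant b_def)
  finally have "a * ((Q ^ 3 - Q) * (Q ^ 3 - Q ^ 2)) = (Q ^ 5 - 1) * (Q ^ 5 - Q)
      - (Q ^ 2 - 1) * ((Q ^ 4 + Q ^ 2 + 1) * (Q ^ 5 - 1)) + b * ((Q ^ 2 - 1) * (Q - 1))"
    unfolding pairs points .
  \<comment> \<open>The factor \<open>Q ^ 3 - 1\<close> is introduced because \<open>blocks\<close>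
    determines \<open>b\<close> only through \<open>b * (Q ^ 3 - 1)\<close>.\<close>
  then have "a * ((Q ^ 3 - Q) * (Q ^ 3 - Q ^ 2)) * (Q ^ 3 - 1)
      = ((Q ^ 5 - 1) * (Q ^ 5 - Q) - (Q ^ 2 - 1) * ((Q ^ 4 + Q ^ 2 + 1) * (Q ^ 5 - 1))) * (Q ^ 3 - 1)
        + (b * (Q ^ 3 - 1)) * ((Q ^ 2 - 1) * (Q - 1))"
    by algebra
  also have "\<dots> = (Q ^ 2 + 1) * ((Q ^ 3 - Q) * (Q ^ 3 - Q ^ 2)) * (Q ^ 3 - 1)"
    unfolding blocks by algebra
  finally have "a = Q ^ 2 + 1"
    using pos by simp
  then have "int (card {U\<in>D. U \<subseteq> W}) = int (CARD('a) ^ 2 + 1)"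
    by (simp add: a_def Q_def)
  then show ?thesis by (simp only: of_nat_eq_iff)
qed

text \<open>The number is \<open>(q^5 - 1) / (q - 1)\<close>, written so that its second summand is
  the number of planes \<open>K\<close> through \<open>T\<close> for which \<open>perp K\<close>
  contains a block.\<close>

lemma card_planes_on_line:
  assumes "subspace T" "dim T = 2"
  shows "card {K. subspace K \<and> T \<subseteq> K \<and> dim K = 3}
    = CARD('a) ^ 4 + (CARD('a) ^ 2 + 1) * (CARD('a) + 1)"
proof -
  let ?q = "CARD('a)"
  have "card {K. subspace K \<and> T \<subseteq> K \<and> dim K = 3} * (?q - 1) = ?q ^ 5 - 1"
    using card_subspaces_between[OF assms(1) subspace_UNIV] assms(2) card_Basis by simp
  also have "\<dots> = (?q ^ 4 + (?q ^ 2 + 1) * (?q + 1)) * (?q - 1)"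
    by (simp add: algebra_simps eval_nat_numeral)
  finally show ?thesis
    by (subst (asm) mult_cancel2) (use CARD_field_ge_2 in simp)
qed

text \<open>By duality the planes counted are those between \<open>T\<close> and
  \<open>perp U\<close>, for a block \<open>U\<close> inside the 5-dimensional
  \<open>perp T\<close>. There are \<open>q^2 + 1\<close> such blocks, each giving
  \<open>q + 1\<close> planes, and no plane arises from two blocks.\<close>

lemma card_planes_perp_block:
  assumes T: "subspace T" "dim T = 2"
  shows "card {K. subspace K \<and> T \<subseteq> K \<and> dim K = 3 \<and> (\<exists>U\<in>D. U \<subseteq> perp K)}
    = (CARD('a) ^ 2 + 1) * (CARD('a) + 1)"
proof -
  let ?E = "{U\<in>D. T \<subseteq> perp U}"
  let ?F = "\<lambda>U. {K. subspace K \<and> T \<subseteq> K \<and> K \<subseteq> perp U \<and> dim K = 3}"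
  have "{K. subspace K \<and> T \<subseteq> K \<and> dim K = 3 \<and> (\<exists>U\<in>D. U \<subseteq> perp K)} =
      {K. subspace K \<and> T \<subseteq> K \<and> dim K = 3 \<and> (\<exists>U\<in>D. K \<subseteq> perp U)}"
    by (simp only: subset_perp_iff)
  also have "\<dots> = (\<Union>U\<in>?E. ?F U)"
    by blast
  finally have eq: "{K. subspace K \<and> T \<subseteq> K \<and> dim K = 3 \<and> (\<exists>U\<in>D. U \<subseteq> perp K)} =
      (\<Union>U\<in>?E. ?F U)" .
  have "card (\<Union>U\<in>?E. ?F U) = (\<Sum>U\<in>?E. card (?F U))"
  proof (intro card_UN_disjoint finite_any_family ballI impI)
    fix U U' assume U: "U \<in> ?E" "U' \<in> ?E" "U \<noteq> U'"
    show "?F U \<inter> ?F U' = {}"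
    proof (rule ccontr)
      assume "?F U \<inter> ?F U' \<noteq> {}"
      then obtain K where "dim K = 3" "K \<subseteq> perp U" "K \<subseteq> perp U'"
        by blast
      then have K: "dim K = 3" "U \<subseteq> perp K" "U' \<subseteq> perp K"
        by (simp_all only: subset_perp_iff[of _ K])
      \<comment> \<open>Two 3-dimensional subspaces of a 4-dimensional space meet in dimension at
        least 3 + 3 - 4 = 2, so the two blocks would coincide.\<close>
      have "dim (perp K) = 4" using dim_perp[of K] K card_Basis by simp
      then have "2 \<le> dim (U \<inter> U')"
        using dim_Int_ge[of U U' "perp K"] K U subspace_block dim_block subspace_perp by simp
      then show False using block_unique U by blast
    qed
  qed
  also have "\<dots> = (\<Sum>U\<in>?E. CARD('a) + 1)"
  proof (rule sum.cong[OF refl])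
    fix U assume U: "U \<in> ?E"
    then have "dim U = 3" by (simp add: dim_block)
    then have "dim (perp U) = 4" using dim_perp[of U] card_Basis by linarith
    then show "card (?F U) = CARD('a) + 1"
      using card_subspaces_between_codim_2[OF T(1) subspace_perp, of U] T(2) U
      by simp
  qed
  also have "\<dots> = (CARD('a) ^ 2 + 1) * (CARD('a) + 1)"
    using card_blocks_subset[OF subspace_perp, of T] dim_perp[of T] T card_Basis
    by (simp add: subset_perp_iff[of T])
  finally show ?thesis unfolding eq .
qed

lemma card_planes_perp_no_block:
  assumes T: "subspace T" "dim T = 2"
  shows "card {K. subspace K \<and> T \<subseteq> K \<and> dim K = 3 \<and> \<not> (\<exists>U\<in>D. U \<subseteq> perp K)} = CARD('a) ^ 4"
proof -
  let ?A = "{K. subspace K \<and> T \<subseteq> K \<and> dim K = 3}"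
  let ?B = "{K. subspace K \<and> T \<subseteq> K \<and> dim K = 3 \<and> (\<exists>U\<in>D. U \<subseteq> perp K)}"
  have eq: "{K. subspace K \<and> T \<subseteq> K \<and> dim K = 3 \<and> \<not> (\<exists>U\<in>D. U \<subseteq> perp K)} = ?A - ?B"
    by blast
  have "card (?A - ?B) = card ?A - card ?B"
    by (intro card_Diff_subset finite_any_family) blast
  then show ?thesis
    unfolding eq card_planes_on_line[OF T] card_planes_perp_block[OF T] by simp
qed

end

theorem theorem4p1:
  fixes q :: nat
    and scale :: "'a::{field,finite} \<Rightarrow> 'b::ab_group_add \<Rightarrow> 'b"
  assumes "primepow q"
    and "\<exists>D. subspace_design q scale 2 7 3 1 D"
  shows "\<exists>D. subspace_design q scale 2 7 3 (q ^ 4) D"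
proof -
  from assms(2) obtain D B where q: "CARD('a) = q"
    and B: "finite_dimensional_vector_space scale B" "card B = 7"
    and D: "\<forall>U\<in>D. module.subspace scale U \<and> vector_space.dim scale U = 3"
      "\<forall>T. module.subspace scale T \<and> vector_space.dim scale T = 2 \<longrightarrow> card {U\<in>D. T \<subseteq> U} = 1"
    unfolding subspace_design_def by blast
  interpret finite_dimensional_vector_space scale B by (rule B(1))
  interpret subspace_fano_plane scale B D
    using D B(2) by unfold_locales auto
  \<comment> \<open>The new blocks are the duals, under the dot product of the chosen basis
    \<open>B\<close>, of the 4-dimensional subspaces that contain no block of
    \<open>D\<close>.\<close>
  have "subspace_design q scale 2 7 3 (q ^ 4)
      {K. subspace K \<and> dim K = 3 \<and> \<not> (\<exists>U\<in>D. U \<subseteq> perp K)}"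
    unfolding subspace_design_def
    using q B card_planes_perp_no_block by (auto simp: conj_ac)
  then show ?thesis by blast
qed

end
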